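(* Let $m\ge 2$, $l\ge 1$ and $n\ge 0$ be integers, and let $c_n(\mathcal{K}_{m,m}(l))$ be the $n$-cone of the $l$-duplication of the complete bipartite graph $\mathcal{K}_{m,m}$ with $m$ vertices in each part. Put $r=\gcd(l,n)$ and $s=\gcd(ml,n)$. Then \[ K(c_n(\mathcal{K}_{m,m}(l)))\cong\mathbb{Z}_r^{\,2}\oplus\mathbb{Z}_{n+ml}^{\,2(m-2)}\oplus\mathbb{Z}_{(n+ml)s/r}\oplus\mathbb{Z}_{n(n+ml)(n+2ml)/(rs)}. \]
   Context: For a simple graph $\mathcal{G}$ and an integer $l\ge 1$, the $l$-duplication $\mathcal{G}(l)$ is the multigraph obtained by replacing every edge of $\mathcal{G}$ by $l$ parallel edges. For a multigraph $\mathcal{H}$ and an integer $k\ge 0$, the $k$-cone $c_k(\mathcal{H})$ is the multigraph obtained by adding a new vertex (the sink) and $k$ parallel edges between the sink and every vertex of $\mathcal{H}$. The Laplacian is $L=D-A$ ($D$ the diagonal degree matrix, $A$ the adjacency matrix counting edge multiplicities), and the reduced Laplacian is obtained by deleting the row and column of the sink; for $c_k(\mathcal{H})$ it equals $L(\mathcal{H})+kI$. The critical group $K(c_k(\mathcal{H}))$ is the cokernel over $\mathbb{Z}$ of (the transpose of) this reduced Laplacian, i.e. $\mathbb{Z}^{V(\mathcal{H})}/\mathrm{Im}(L(\mathcal{H})+kI)^t$. $\mathbb{Z}_d=\mathbb{Z}/d\mathbb{Z}$, with $\mathbb{Z}_0=\mathbb{Z}$. *)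

theory Defs
  imports "HOL-Algebra.Algebra" "HOL-Library.Multiset"
begin

text \<open>
  Finite loopless undirected multigraphs. An edge is the set of its two ends, and parallel
  edges are repetitions in the multiset of edges.
\<close>

record 'v multigraph =
  verts :: "'v set"
  edges :: "'v set multiset"

definition wf_multigraph :: "'v multigraph \<Rightarrow> bool" where
  "wf_multigraph G \<longleftrightarrow> finite (verts G) \<and> (\<forall>e \<in># edges G. e \<subseteq> verts G \<and> card e = 2)"

definition simple_graph :: "'v multigraph \<Rightarrow> bool" where
  "simple_graph G \<longleftrightarrow> wf_multigraph G \<and> (\<forall>e. count (edges G) e \<le> 1)"

definition complete_bipartite :: "nat \<Rightarrow> nat \<Rightarrow> (nat + nat) multigraph" where
  "complete_bipartite p q =
     \<lparr>verts = Inl ` {..<p} \<union> Inr ` {..<q},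
      edges = mset_set {{Inl i, Inr j} | i j. i < p \<and> j < q}\<rparr>"

definition duplication :: "nat \<Rightarrow> 'v multigraph \<Rightarrow> 'v multigraph" where
  "duplication l G = \<lparr>verts = verts G, edges = repeat_mset l (edges G)\<rparr>"

text \<open>In the cone the sink is \<open>None\<close>, and a vertex \<open>v\<close> of the base becomes \<open>Some v\<close>.\<close>

definition k_cone :: "nat \<Rightarrow> 'v multigraph \<Rightarrow> 'v option multigraph" where
  "k_cone k H =
     \<lparr>verts = insert None (Some ` verts H),
      edges = image_mset (image Some) (edges H)
                + repeat_mset k (mset_set ((\<lambda>v. {None, Some v}) ` verts H))\<rparr>"

definition vertex_degree :: "'v multigraph \<Rightarrow> 'v \<Rightarrow> nat" where
  "vertex_degree G v = size {#e \<in># edges G. v \<in> e#}"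

text \<open>For \<open>u = v\<close> this counts the edges \<open>{u}\<close>, of which a loopless multigraph has none.\<close>

definition adjacency :: "'v multigraph \<Rightarrow> 'v \<Rightarrow> 'v \<Rightarrow> nat" where
  "adjacency G u v = count (edges G) {u, v}"

definition laplacian :: "'v multigraph \<Rightarrow> 'v \<Rightarrow> 'v \<Rightarrow> int" where
  "laplacian G u v = (if u = v then int (vertex_degree G v) else 0) - int (adjacency G u v)"

definition int_power_group :: "'v set \<Rightarrow> ('v \<Rightarrow> int) monoid" where
  "int_power_group I = product_group I (\<lambda>_. integer_group)"

definition transpose_map :: "'v set \<Rightarrow> ('v \<Rightarrow> 'v \<Rightarrow> int) \<Rightarrow> ('v \<Rightarrow> int) \<Rightarrow> ('v \<Rightarrow> int)" where
  "transpose_map I M x = (\<lambda>v\<in>I. \<Sum>u\<in>I. M u v * x u)"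

text \<open>
  Matrices are functions of a row and a column index. The reduced Laplacian is the Laplacian
  with both indices restricted to the vertices other than the sink.
\<close>

definition critical_group :: "'v multigraph \<Rightarrow> 'v \<Rightarrow> ('v \<Rightarrow> int) set monoid" where
  "critical_group G sink =
     (let W = verts G - {sink}
      in int_power_group W Mod (transpose_map W (laplacian G) ` carrier (int_power_group W)))"

lemma set_mset_repeat: "set_mset (repeat_mset k M) = (if k = 0 then {} else set_mset M)"
  by (auto simp flip: count_greater_zero_iff)

lemma wf_complete_bipartite: "wf_multigraph (complete_bipartite p q)"
  and simple_complete_bipartite: "simple_graph (complete_bipartite p q)"
proof -
  let ?E = "{{Inl i, Inr j} | i j. i < p \<and> j < q} :: (nat + nat) set set"
  have "?E = (\<lambda>(i, j). {Inl i, Inr j}) ` ({..<p} \<times> {..<q})"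
    by auto
  then have fin: "finite ?E"
    by simp
  show wf: "wf_multigraph (complete_bipartite p q)"
    using fin by (auto simp: wf_multigraph_def complete_bipartite_def)
  show "simple_graph (complete_bipartite p q)"
    using wf by (simp add: simple_graph_def complete_bipartite_def count_mset_set')
qed

lemma wf_duplication: "wf_multigraph G \<Longrightarrow> wf_multigraph (duplication l G)"
  by (simp add: wf_multigraph_def duplication_def set_mset_repeat)

lemma wf_k_cone:
  assumes "wf_multigraph H"
  shows "wf_multigraph (k_cone k H)"
proof -
  have fin: "finite (verts H)"
    using assms by (simp add: wf_multigraph_def)
  have "e \<subseteq> verts (k_cone k H) \<and> card e = 2" if "e \<in># edges (k_cone k H)" for e
  proof -
    have "e \<in> image Some ` set_mset (edges H) \<union> (\<lambda>v. {None, Some v}) ` verts H"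
      using that fin by (auto simp: k_cone_def set_mset_repeat split: if_splits)
    then consider e' where "e' \<in># edges H" "e = Some ` e'"
      | v where "v \<in> verts H" "e = {None, Some v}"
      by blast
    then show ?thesis
      using assms by cases (auto simp: k_cone_def wf_multigraph_def card_image)
  qed
  then show ?thesis
    using assms by (simp add: wf_multigraph_def k_cone_def)
qed

lemma count_image_mset_inj: "inj f \<Longrightarrow> count (image_mset f M) (f x) = count M x"
  by (induction M) (auto simp: inj_eq)

lemma laplacian_k_cone:
  assumes H: "wf_multigraph H" and uv: "u \<in> verts H" "v \<in> verts H"
  shows "laplacian (k_cone k H) (Some u) (Some v) = laplacian H u v + (if u = v then int k else 0)"
proof -
  let ?S = "mset_set ((\<lambda>v. {None, Some v}) ` verts H)"
  have fin: "finite (verts H)"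
    using H by (simp add: wf_multigraph_def)
  have inj: "inj (image (Some :: 'a \<Rightarrow> 'a option))"
    by (simp add: inj_image_eq_iff inj_def)
  have "count (image_mset (image Some) (edges H)) (Some ` {u, v}) = count (edges H) {u, v}"
    by (rule count_image_mset_inj [OF inj])
  moreover have "count ?S {Some u, Some v} = 0"
    by (auto simp: count_eq_zero_iff fin)
  ultimately have adj: "adjacency (k_cone k H) (Some u) (Some v) = adjacency H u v"
    by (simp add: adjacency_def k_cone_def)
  have "{e \<in> (\<lambda>v. {None, Some v}) ` verts H. Some v \<in> e} = {{None, Some v}}"
    using uv by auto
  then have "size {#e \<in># ?S. Some v \<in> e#} = 1"
    using fin by (simp add: filter_mset_mset_set)
  moreover have "filter_mset P (repeat_mset k M) = repeat_mset k (filter_mset P M)"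
    for P and M :: "'a option set multiset"
    by (simp add: multiset_eq_iff)
  moreover have "size {#e \<in># image_mset (image Some) (edges H). Some v \<in> e#}
      = size {#e \<in># edges H. v \<in> e#}"
    by (simp add: filter_mset_image_mset inj_image_mem_iff image_iff)
  ultimately have "vertex_degree (k_cone k H) (Some v) = vertex_degree H v + k"
    by (simp add: vertex_degree_def k_cone_def)
  with adj show ?thesis
    by (simp add: laplacian_def)
qed

lemma normal_transpose_map:
  "transpose_map I M ` carrier (int_power_group I) \<lhd> int_power_group I"
proof -
  have grp: "comm_group (int_power_group I)"
    unfolding int_power_group_def
    by (intro group.group_comm_groupI) (auto simp: fun_eq_iff)
  interpret comm_group "int_power_group I" by (fact grp)
  have "transpose_map I M \<in> hom (int_power_group I) (int_power_group I)"
    by (auto simp: hom_def transpose_map_def int_power_group_def fun_eq_iff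
        distrib_left sum.distrib)
  then interpret h: group_hom "int_power_group I" "int_power_group I" "transpose_map I M"
    by unfold_locales
  show ?thesis
    using h.img_is_subgroup by (rule subgroup_imp_normal)
qed

end

(* Put a = n + m l. The group has generators x_i, y_j (i, j < m) and relations
   a x_i = l Y, a y_j = l X, where X and Y are the sums of the x_i and of the y_j. The
   differences x_i - x_0, y_i - y_0 (i >= 2) together with x_0, X, y_0, Y form a basis of the
   free group; the differences contribute 2 (m - 2) copies of Z_a, and what remains is
   a x_0 = l Y, a y_0 = l X, a X = m l Y, a Y = m l X.
   Write a = r u, l = r k with p u + q k = 1. In the basis e = u x_0 - k Y, g = q x_0 + p Y,
   and likewise e' = u y_0 - k X, g' = q y_0 + p X, the first two relations say r e = r e' = 0
   and the others become r (u^2 g' - m k u g) = r (u^2 g - m k u g') = 0.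
   Write u = sigma alpha, m k = sigma beta with c alpha + d beta = 1, and pass to the basis
   b = alpha g' - beta g, f = d g' + c g: these last relations generate the same subgroup as
   a sigma b and a sigma (alpha^2 - beta^2) f, which is the claimed decomposition because
   s = r sigma. *)

theory Submission
  imports Defs
begin

section \<open>Coordinates on one side of the bipartition\<close>

text \<open>For m >= 2 the combination of the x_i with coefficients \<open>z i\<close> equals
  \<open>excess m z\<close> x_1 + \<open>z 0\<close> X + the sum over i >= 2 of (\<open>z i\<close>
  - \<open>z 0\<close>) (x_i - x_1); so x_1 stands where the introduction has x_0.\<close>

definition excess :: "nat \<Rightarrow> (nat \<Rightarrow> int) \<Rightarrow> int" where
  "excess m z = (\<Sum>i<m. z i) - int m * z 0"

lemma sum_lessThan_split2:
  fixes f :: "nat \<Rightarrow> int"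
  assumes "m \<ge> 2"
  shows "(\<Sum>i<m. f i) = f 0 + f 1 + (\<Sum>i<m - 2. f (i + 2))"
proof -
  obtain k where "m = Suc (Suc k)"
    using assms by (metis add_2_eq_Suc le_Suc_ex)
  then show ?thesis
    by (simp add: sum.lessThan_Suc_shift del: sum.lessThan_Suc)
qed

text \<open>Entry 1 enters the excess with coefficient 1 and is not among the prescribed entries, so
  it can be solved for.\<close>

lemma ex_excess:
  assumes "m \<ge> 2"
  shows "\<exists>z. z 0 = z0 \<and> excess m z = A \<and> (\<forall>i<m - 2. z (i + 2) = z0 + g i)"
proof -
  let ?b = "A + int m * z0 - z0 - (\<Sum>i<m - 2. z0 + g i)"
  let ?z = "\<lambda>i. if i = 0 then z0 else if i = 1 then ?b else z0 + g (i - 2)"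
  show ?thesis
    by (rule exI [of _ ?z]) (simp add: excess_def sum_lessThan_split2 [OF assms])
qed

lemma excess_eqI:
  assumes "m \<ge> 2" and "excess m z = excess m z'" and "z 0 = z' 0"
    and "\<And>i. i < m - 2 \<Longrightarrow> z (i + 2) = z' (i + 2)" and "i < m"
  shows "z i = z' i"
proof -
  have "z 1 = z' 1"
    using assms(2-4) by (simp add: excess_def sum_lessThan_split2 [OF assms(1)])
  then show ?thesis
    using assms(3) assms(4)[of "i - 2"] assms(5)
    by (cases i; cases "i - 1") auto
qed

lemma excess_add: "excess m (\<lambda>i. x i + y i) = excess m x + excess m y"
  by (simp add: excess_def sum.distrib algebra_simps)

text \<open>Constant vectors have excess 0. Hence the multiple of \<open>l\<close> in each equation
  of \<open>in_image\<close>, which is the same for all i, drops out of the excess.\<close>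

lemma excess_affine: "excess m (\<lambda>i. a * x i - b) = a * excess m x"
  by (simp add: excess_def sum_subtractf sum_distrib_left [symmetric] algebra_simps)

section \<open>Coordinates on both sides that diagonalise the relations\<close>

text \<open>
  Let \<open>z\<close>, \<open>w\<close> be the coefficient vectors on the two sides. In the basis of differences from the
  introduction \<open>excess m z\<close> is the coefficient of \<open>x_0\<close> and \<open>z 0\<close> that of \<open>X\<close>. Moreover
  \<open>e_coord z w\<close> and \<open>e_coord w z\<close> are the coefficients of \<open>e\<close> and \<open>e'\<close>, \<open>g_coord z w\<close> and \<open>g_coord w z\<close> those of \<open>g\<close>
  and \<open>g'\<close>, and \<open>b_coord z w\<close>, \<open>f_coord z w\<close> those of \<open>b\<close> and \<open>f\<close>.
\<close>

locale bezout_data =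
  fixes m :: nat and a l r \<sigma> u k \<alpha> \<beta> p q c d :: int
  assumes m2: "m \<ge> 2"
    and a_eq: "a = r * u" and l_eq: "l = r * k"
    and u_eq: "u = \<sigma> * \<alpha>" and mk_eq: "int m * k = \<sigma> * \<beta>"
    and pq: "p * u + q * k = 1" and cd: "c * \<alpha> + d * \<beta> = 1"
begin

text \<open>The witnesses \<open>x\<close> and \<open>y\<close> are the multipliers of the relations
  belonging to the vertices of the two sides.\<close>

definition in_image :: "(nat \<Rightarrow> int) \<Rightarrow> (nat \<Rightarrow> int) \<Rightarrow> bool" where
  "in_image z w \<longleftrightarrow> (\<exists>x y. \<forall>i<m. z i = a * x i - l * (\<Sum>j<m. y j) \<and> w i = a * y i - l * (\<Sum>j<m. x j))"

definition e_coord where "e_coord z w = p * excess m z - q * w 0"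
definition g_coord where "g_coord z w = k * excess m z + u * w 0"
definition b_coord where "b_coord z w = c * g_coord w z - d * g_coord z w"
definition f_coord where "f_coord z w = \<beta> * g_coord w z + \<alpha> * g_coord z w"

(* HOL-Algebra redefines the method algebra, hence the qualified name. *)
lemma excess_eq: "excess m z = u * e_coord z w + q * g_coord z w"
  using pq unfolding e_coord_def g_coord_def by Groebner_Basis.algebra

text \<open>Together with \<open>excess_eq\<close> this inverts the passage to e and g, whose
  determinant is p u + q k = 1; \<open>g_coord_eq\<close> likewise inverts the passage to b and f by
  c \<alpha> + d \<beta> = 1.\<close>

lemma w0_eq: "w 0 = - k * e_coord z w + p * g_coord z w"
  using pq unfolding e_coord_def g_coord_def by Groebner_Basis.algebra

lemma g_coord_eq: "g_coord z w = c * f_coord z w - \<beta> * b_coord z w" "g_coord w z = \<alpha> * b_coord z w + d * f_coord z w"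
  using cd unfolding b_coord_def f_coord_def by Groebner_Basis.algebra+

lemma in_image_imp:
  assumes "in_image z w"
  shows "r dvd e_coord z w" "r dvd e_coord w z" "a * \<sigma> dvd b_coord z w" "a * \<sigma> * (\<alpha>\<^sup>2 - \<beta>\<^sup>2) dvd f_coord z w"
    "\<And>i. i < m - 2 \<Longrightarrow> a dvd z (i + 2) - z 0" "\<And>i. i < m - 2 \<Longrightarrow> a dvd w (i + 2) - w 0"
proof -
  obtain x y where z: "\<And>i. i < m \<Longrightarrow> z i = a * x i - l * (\<Sum>j<m. y j)"
    and w: "\<And>i. i < m \<Longrightarrow> w i = a * y i - l * (\<Sum>j<m. x j)"
    using assms unfolding in_image_def by blast
  define Sx Sy where S: "Sx = (\<Sum>j<m. x j)" "Sy = (\<Sum>j<m. y j)"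
  have m0: "0 < m" using m2 by simp
  have ez: "excess m z = a * (Sx - int m * x 0)"
  proof -
    have "excess m z = excess m (\<lambda>i. a * x i - l * (\<Sum>j<m. y j))"
      using z m0 by (simp add: excess_def)
    then show ?thesis by (simp add: excess_affine excess_def S)
  qed
  have ew: "excess m w = a * (Sy - int m * y 0)"
  proof -
    have "excess m w = excess m (\<lambda>i. a * y i - l * (\<Sum>j<m. x j))"
      using w m0 by (simp add: excess_def)
    then show ?thesis by (simp add: excess_affine excess_def S)
  qed
  have z0: "z 0 = a * x 0 - l * Sy" and w0: "w 0 = a * y 0 - l * Sx"
    using z w m0 by (simp_all add: S)
  \<comment> \<open>The sum \<open>Sx\<close> cancels because k a = l u, and \<open>Sy\<close>
    cancels likewise in \<open>gw\<close>; only the multipliers at index 0 survive.\<close>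
  have gz: "g_coord z w = a * \<sigma> * (\<alpha> * y 0 - \<beta> * x 0)"
    unfolding g_coord_def ez w0 using a_eq l_eq u_eq mk_eq by Groebner_Basis.algebra
  have gw: "g_coord w z = a * \<sigma> * (\<alpha> * x 0 - \<beta> * y 0)"
    unfolding g_coord_def ew z0 using a_eq l_eq u_eq mk_eq by Groebner_Basis.algebra
  have "r dvd a" "r dvd l"
    by (simp_all add: a_eq l_eq)
  then show "r dvd e_coord z w" "r dvd e_coord w z"
    unfolding e_coord_def ez ew z0 w0 by simp_all
  have "b_coord z w = a * \<sigma> * (c * (\<alpha> * x 0 - \<beta> * y 0) - d * (\<alpha> * y 0 - \<beta> * x 0))"
    unfolding b_coord_def gz gw by Groebner_Basis.algebra
  then show "a * \<sigma> dvd b_coord z w"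
    by simp
  \<comment> \<open>The terms in \<open>x 0\<close> cancel, which is the purpose of the weights
    \<beta> and \<alpha> in \<open>f_coord\<close>.\<close>
  have "f_coord z w = a * \<sigma> * (\<alpha>\<^sup>2 - \<beta>\<^sup>2) * y 0"
    unfolding f_coord_def gz gw by (simp add: algebra_simps power2_eq_square)
  then show "a * \<sigma> * (\<alpha>\<^sup>2 - \<beta>\<^sup>2) dvd f_coord z w"
    by simp
  show "a dvd z (i + 2) - z 0" "a dvd w (i + 2) - w 0" if "i < m - 2" for i
  proof -
    have "z (i + 2) - z 0 = a * (x (i + 2) - x 0)" "w (i + 2) - w 0 = a * (y (i + 2) - y 0)"
      using less_diff_conv[THEN iffD1, OF that] z[of "i + 2"] w[of "i + 2"] z0 w0
      by (simp_all add: S algebra_simps)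
    then show "a dvd z (i + 2) - z 0" "a dvd w (i + 2) - w 0" by simp_all
  qed
qed

text \<open>The quotients in the divisibilities determine the entry at 0, the excess and the
  differences of suitable multipliers, and these data suffice to build both vectors.\<close>

lemma in_image_if:
  assumes "r dvd e_coord z w" "r dvd e_coord w z" "a * \<sigma> dvd b_coord z w" "a * \<sigma> * (\<alpha>\<^sup>2 - \<beta>\<^sup>2) dvd f_coord z w"
    and dz: "\<And>i. i < m - 2 \<Longrightarrow> a dvd z (i + 2) - z 0"
    and dw: "\<And>i. i < m - 2 \<Longrightarrow> a dvd w (i + 2) - w 0"
  shows "in_image z w"
proof -
  obtain f1 f2 K y0 where f1: "e_coord z w = r * f1" and f2: "e_coord w z = r * f2"
    and K: "b_coord z w = a * \<sigma> * K" and y0: "f_coord z w = a * \<sigma> * (\<alpha>\<^sup>2 - \<beta>\<^sup>2) * y0"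
    using assms(1-4) by (auto elim!: dvdE)
  \<comment> \<open>Multipliers with entries x0 and y0 at index 0 have \<open>b_coord\<close> equal
    to a \<sigma> (x0 - (c \<beta> + d \<alpha>) y0); x0 makes the bracket K.\<close>
  define x0 where "x0 = K + (c * \<beta> + d * \<alpha>) * y0"
  have gz: "g_coord z w = a * \<sigma> * (\<alpha> * y0 - \<beta> * x0)"
    using cd unfolding g_coord_eq(1) K y0 x0_def by Groebner_Basis.algebra
  have gw: "g_coord w z = a * \<sigma> * (\<alpha> * x0 - \<beta> * y0)"
    using cd unfolding g_coord_eq(2) K y0 x0_def by Groebner_Basis.algebra
  \<comment> \<open>The excess of z must be a times that of the multiplier x; \<open>ex\<close> is
    \<open>excess_eq\<close> divided by a = r u, and \<open>ey\<close> is its mirror image.\<close>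
  define ex ey where e: "ex = f1 + q * \<sigma> * (\<alpha> * y0 - \<beta> * x0)" "ey = f2 + q * \<sigma> * (\<alpha> * x0 - \<beta> * y0)"
  have ez: "excess m z = a * ex" and ew: "excess m w = a * ey"
    unfolding excess_eq[of z w] excess_eq[of w z] f1 f2 gz gw e a_eq by Groebner_Basis.algebra+
  \<comment> \<open>The quotients by a are exact by \<open>dz\<close>, and by \<open>dw\<close> for
    y.\<close>
  obtain x where x: "x 0 = x0" "excess m x = ex" "\<And>i. i < m - 2 \<Longrightarrow> x (i + 2) = x0 + (z (i + 2) - z 0) div a"
    using ex_excess[OF m2, of x0 ex "\<lambda>i. (z (i + 2) - z 0) div a"] by auto
  obtain y where y: "y 0 = y0" "excess m y = ey" "\<And>i. i < m - 2 \<Longrightarrow> y (i + 2) = y0 + (w (i + 2) - w 0) div a"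
    using ex_excess[OF m2, of y0 ey "\<lambda>i. (w (i + 2) - w 0) div a"] by auto
  have Sx: "(\<Sum>j<m. x j) = ex + int m * x0" and Sy: "(\<Sum>j<m. y j) = ey + int m * y0"
    using x y by (simp_all add: excess_def)
  have z0: "z 0 = a * x0 - l * (ey + int m * y0)"
    using pq a_eq l_eq u_eq mk_eq unfolding w0_eq[of z w] f2 gw e by Groebner_Basis.algebra
  have w0: "w 0 = a * y0 - l * (ex + int m * x0)"
    using pq a_eq l_eq u_eq mk_eq unfolding w0_eq[of w z] f1 gz e by Groebner_Basis.algebra
  have "z i = a * x i - l * (\<Sum>j<m. y j)" if "i < m" for i
  proof (rule excess_eqI[OF m2 _ _ _ that])
    show "excess m z = excess m (\<lambda>i. a * x i - l * (\<Sum>j<m. y j))"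
      by (simp add: excess_affine x ez)
    show "z 0 = a * x 0 - l * (\<Sum>j<m. y j)"
      by (simp add: x Sy z0)
    show "z (i + 2) = a * x (i + 2) - l * (\<Sum>j<m. y j)" if "i < m - 2" for i
      using dz[OF that] x(3)[OF that] by (simp add: distrib_left Sy z0)
  qed
  moreover have "w i = a * y i - l * (\<Sum>j<m. x j)" if "i < m" for i
  proof (rule excess_eqI[OF m2 _ _ _ that])
    show "excess m w = excess m (\<lambda>i. a * y i - l * (\<Sum>j<m. x j))"
      by (simp add: excess_affine y ew)
    show "w 0 = a * y 0 - l * (\<Sum>j<m. x j)"
      by (simp add: y Sx w0)
    show "w (i + 2) = a * y (i + 2) - l * (\<Sum>j<m. x j)" if "i < m - 2" for i
      using dw[OF that] y(3)[OF that] by (simp add: distrib_left Sx w0)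
  qed
  ultimately show ?thesis
    unfolding in_image_def by blast
qed

text \<open>Both changes of basis are unimodular, so all coordinates can be prescribed freely. This
  gives surjectivity in \<open>cokernel_iso\<close>.\<close>

lemma ex_coordinates:
  "\<exists>z w. e_coord z w = t1 \<and> e_coord w z = t2 \<and> b_coord z w = t3 \<and> f_coord z w = t4 \<and>
     (\<forall>i<m - 2. z (i + 2) - z 0 = g i \<and> w (i + 2) - w 0 = h i)"
proof -
  \<comment> \<open>The values forced on \<open>g_coord z w\<close> and \<open>g_coord w z\<close>
    by \<open>g_coord_eq\<close>.\<close>
  define G E where GE: "G = c * t4 - \<beta> * t3" "E = \<alpha> * t3 + d * t4"
  obtain z where z: "z 0 = - k * t2 + p * E" "excess m z = u * t1 + q * G"
      "\<And>i. i < m - 2 \<Longrightarrow> z (i + 2) - z 0 = g i"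
    using ex_excess[OF m2, of "- k * t2 + p * E" "u * t1 + q * G" g] by auto
  obtain w where w: "w 0 = - k * t1 + p * G" "excess m w = u * t2 + q * E"
      "\<And>i. i < m - 2 \<Longrightarrow> w (i + 2) - w 0 = h i"
    using ex_excess[OF m2, of "- k * t1 + p * G" "u * t2 + q * E" h] by auto
  have g: "g_coord z w = G" "g_coord w z = E" and "e_coord z w = t1" "e_coord w z = t2"
    using pq unfolding g_coord_def e_coord_def z(1,2) w(1,2) by Groebner_Basis.algebra+
  moreover have "b_coord z w = t3" "f_coord z w = t4"
    using cd unfolding b_coord_def f_coord_def g GE by Groebner_Basis.algebra+
  ultimately show ?thesis
    using z(3) w(3) by blast
qed

end

section \<open>Residues, and vectors indexed by the non-sink vertices\<close>

lemma mod_in_carrier: "x mod int d \<in> carrier (integer_mod_group d)"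
  by (simp add: carrier_integer_mod_group)

text \<open>This covers d = 0, where the group is that of the integers and
  \<open>x mod 0 = x\<close>; the last factor of the theorem has this form when n = 0.\<close>

lemma mod_carrier_id: "x \<in> carrier (integer_mod_group d) \<Longrightarrow> x mod int d = x"
  by (simp add: carrier_integer_mod_group split: if_splits)

definition sides :: "nat \<Rightarrow> (nat + nat) option set" where
  "sides m = Some ` (Inl ` {..<m} \<union> Inr ` {..<m})"

text \<open>The value 0 from m on makes \<open>left m\<close> additive as an equation of functions,
  although products in the power group are undefined outside \<open>sides m\<close>.\<close>

definition left :: "nat \<Rightarrow> ((nat + nat) option \<Rightarrow> int) \<Rightarrow> nat \<Rightarrow> int" where
  "left m z i = (if i < m then z (Some (Inl i)) else 0)"

definition right :: "nat \<Rightarrow> ((nat + nat) option \<Rightarrow> int) \<Rightarrow> nat \<Rightarrow> int" where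
  "right m z i = (if i < m then z (Some (Inr i)) else 0)"

lemma sum_sides:
  "(\<Sum>v\<in>sides m. f v) = (\<Sum>i<m. f (Some (Inl i))) + (\<Sum>i<m. f (Some (Inr i)))"
proof -
  have "(\<Sum>v\<in>sides m. f v) = (\<Sum>v\<in>Inl ` {..<m} \<union> Inr ` {..<m}. f (Some v))"
    unfolding sides_def by (subst sum.reindex) auto
  also have "\<dots> = (\<Sum>v\<in>Inl ` {..<m}. f (Some v)) + (\<Sum>v\<in>Inr ` {..<m}. f (Some v))"
    by (rule sum.union_disjoint) auto
  finally show ?thesis
    by (simp add: sum.reindex)
qed

lemma group_int_power_group: "group (int_power_group I)"
  by (simp add: int_power_group_def)

lemma int_power_group_sides_mult:
  "left m (x \<otimes>\<^bsub>int_power_group (sides m)\<^esub> y) = (\<lambda>i. left m x i + left m y i)"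
  "right m (x \<otimes>\<^bsub>int_power_group (sides m)\<^esub> y) = (\<lambda>i. right m x i + right m y i)"
  by (auto simp: fun_eq_iff left_def right_def int_power_group_def sides_def)

lemma ex_sides:
  "\<exists>x \<in> carrier (int_power_group (sides m)). \<forall>i<m. left m x i = f i \<and> right m x i = g i"
proof -
  let ?x = "\<lambda>v\<in>sides m. case v of Some (Inl i) \<Rightarrow> f i | Some (Inr i) \<Rightarrow> g i | None \<Rightarrow> 0"
  have "?x \<in> carrier (int_power_group (sides m))"
    by (auto simp: int_power_group_def)
  moreover have "left m ?x i = f i \<and> right m ?x i = g i" if "i < m" for i
    using that by (simp add: left_def right_def sides_def)
  ultimately show ?thesis
    by blast
qed

lemma sides_eqI:
  assumes "x \<in> carrier (int_power_group (sides m))" "y \<in> carrier (int_power_group (sides m))"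
    and "\<And>i. i < m \<Longrightarrow> left m x i = left m y i" "\<And>i. i < m \<Longrightarrow> right m x i = right m y i"
  shows "x = y"
proof (rule PiE_ext)
  show "x \<in> (\<Pi>\<^sub>E v\<in>sides m. UNIV)" "y \<in> (\<Pi>\<^sub>E v\<in>sides m. UNIV)"
    using assms(1,2) by (simp_all add: int_power_group_def)
  show "x v = y v" if "v \<in> sides m" for v
    using that assms(3,4) by (auto simp: sides_def left_def right_def)
qed

section \<open>The cokernel as a product of cyclic groups\<close>

context bezout_data
begin

text \<open>Needed since \<open>ex_sides\<close> realises given vectors only below m.\<close>

lemma coord_cong:
  assumes "\<And>i. i < m \<Longrightarrow> z i = z' i" "\<And>i. i < m \<Longrightarrow> w i = w' i"
  shows "e_coord z w = e_coord z' w'" "b_coord z w = b_coord z' w'" "f_coord z w = f_coord z' w'"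
proof -
  have "excess m z = excess m z'" "excess m w = excess m w'" "z 0 = z' 0" "w 0 = w' 0"
    using assms m2 by (simp_all add: excess_def)
  then show "e_coord z w = e_coord z' w'" "b_coord z w = b_coord z' w'" "f_coord z w = f_coord z' w'"
    by (simp_all add: e_coord_def b_coord_def f_coord_def g_coord_def)
qed

lemma coord_add:
  "e_coord (\<lambda>i. z i + z' i) (\<lambda>i. w i + w' i) = e_coord z w + e_coord z' w'"
  "b_coord (\<lambda>i. z i + z' i) (\<lambda>i. w i + w' i) = b_coord z w + b_coord z' w'"
  "f_coord (\<lambda>i. z i + z' i) (\<lambda>i. w i + w' i) = f_coord z w + f_coord z' w'"
  by (simp_all add: e_coord_def b_coord_def f_coord_def g_coord_def excess_add algebra_simps)

text \<open>Reducing each coordinate modulo its own divisor is a surjective homomorphism whose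
  kernel is the image, by \<open>in_image_imp\<close> and \<open>in_image_if\<close>; the first
  isomorphism theorem applies. All that is used of the graph is in \<open>left_M\<close> and
  \<open>right_M\<close>.\<close>

lemma cokernel_iso:
  assumes R: "int R = r" and N: "int N = a" and D3: "int D3 = a * \<sigma>"
    and D4: "int D4 = a * \<sigma> * (\<alpha>\<^sup>2 - \<beta>\<^sup>2)"
    and left_M: "\<And>x i. i < m \<Longrightarrow> left m (transpose_map (sides m) M x) i
      = a * left m x i - l * (\<Sum>j<m. right m x j)"
    and right_M: "\<And>x i. i < m \<Longrightarrow> right m (transpose_map (sides m) M x) i
      = a * right m x i - l * (\<Sum>j<m. left m x j)"
  shows "int_power_group (sides m) Mod
      (transpose_map (sides m) M ` carrier (int_power_group (sides m))) \<cong>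
    product_group {..<2} (\<lambda>_::nat. integer_mod_group R) \<times>\<times>
    product_group {..<2 * (m - 2)} (\<lambda>_::nat. integer_mod_group N) \<times>\<times>
    integer_mod_group D3 \<times>\<times> integer_mod_group D4"
    (is "?G Mod ?I \<cong> ?P \<times>\<times> ?Q \<times>\<times> ?Z3 \<times>\<times> ?Z4")
proof -
  let ?T = "?P \<times>\<times> ?Q \<times>\<times> ?Z3 \<times>\<times> ?Z4"
  \<comment> \<open>The m - 2 differences of z followed by those of w, as one family.\<close>
  define D where "D z w i = (if i < m - 2 then z (i + 2) - z 0
    else w (i - (m - 2) + 2) - w 0)" for z w :: "nat \<Rightarrow> int" and i
  define E where "E z w i = (if i = (0::nat) then e_coord z w else e_coord w z)" for z w i
  define \<phi> where "\<phi> z w = ((\<lambda>i\<in>{..<2}. E z w i mod int R),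
    (\<lambda>i\<in>{..<2 * (m - 2)}. D z w i mod int N), b_coord z w mod int D3, f_coord z w mod int D4)" for z w
  define h where "h x = \<phi> (left m x) (right m x)" for x
  have D_add: "D (\<lambda>i. z i + z' i) (\<lambda>i. w i + w' i) i = D z w i + D z' w' i"
    and E_add: "E (\<lambda>i. z i + z' i) (\<lambda>i. w i + w' i) i = E z w i + E z' w' i" for z w z' w' i
    by (simp_all add: D_def E_def coord_add)
  have h_hom: "h \<in> hom ?G ?T"
  proof (rule homI)
    show "h x \<in> carrier ?T" for x
      by (simp add: h_def \<phi>_def DirProd_def mod_in_carrier)
    show "h (x \<otimes>\<^bsub>?G\<^esub> y) = h x \<otimes>\<^bsub>?T\<^esub> h y" for x y
      by (simp add: h_def \<phi>_def DirProd_def int_power_group_sides_mult coord_add D_add E_add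
          mod_add_eq fun_eq_iff)
  qed
  have "group ?T"
    by (intro DirProd_group product_group group_integer_mod_group)
  then interpret group_hom ?G ?T h
    using h_hom group_int_power_group by (simp add: group_hom_def group_hom_axioms_def)
  have in_image_iff: "\<phi> z w = \<one>\<^bsub>?T\<^esub> \<longleftrightarrow> in_image z w" for z w
  proof -
    have "\<phi> z w = \<one>\<^bsub>?T\<^esub> \<longleftrightarrow> (\<forall>i<2. E z w i mod int R = 0) \<and>
       (\<forall>i<2 * (m - 2). D z w i mod int N = 0) \<and> b_coord z w mod int D3 = 0 \<and> f_coord z w mod int D4 = 0"
      by (auto simp: \<phi>_def DirProd_def restrict_def fun_eq_iff)
    also have "(\<forall>i<2. E z w i mod int R = 0) \<longleftrightarrow>
        r dvd e_coord z w \<and> r dvd e_coord w z"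
      by (auto simp: E_def R less_2_cases_iff mod_eq_0_iff_dvd)
    also have "(\<forall>i<2 * (m - 2). D z w i mod int N = 0) \<longleftrightarrow>
        (\<forall>i<m - 2. a dvd z (i + 2) - z 0) \<and> (\<forall>i<m - 2. a dvd w (i + 2) - w 0)" (is "?l = ?r")
    proof
      assume l: ?l
      have "a dvd z (i + 2) - z 0" if "i < m - 2" for i
        using l[rule_format, of i] that by (simp add: D_def N mod_eq_0_iff_dvd)
      moreover have "a dvd w (i + 2) - w 0" if "i < m - 2" for i
      proof -
        \<comment> \<open>With b for m - 2 the truncated subtraction in \<open>D\<close> becomes i +
          b - b = i.\<close>
        have "D z w (i + b) = w (i + 2) - w 0" if "b = m - 2" for b
          by (simp add: D_def flip: that)
        then show ?thesis
          using l[rule_format, of "i + (m - 2)"] that by (metis N add_strict_right_mono mod_eq_0_iff_dvd mult_2)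
      qed
      ultimately show ?r
        by blast
    next
      assume r: ?r
      show ?l
      proof (intro allI impI)
        fix i assume "i < 2 * (m - 2)"
        then have "i < m - 2 \<or> i - (m - 2) < m - 2"
          by linarith
        then show "D z w i mod int N = 0"
          using r by (auto simp: D_def N mod_eq_0_iff_dvd)
      qed
    qed
    finally show ?thesis
      using in_image_imp[of z w] in_image_if[of z w] by (auto simp: D3 D4 mod_eq_0_iff_dvd)
  qed
  have "kernel ?G ?T h = ?I"
  proof (intro equalityI subsetI)
    fix z assume "z \<in> kernel ?G ?T h"
    then have z: "z \<in> carrier ?G" and "in_image (left m z) (right m z)"
      unfolding kernel_def h_def in_image_iff by blast+
    then obtain f g where fg: "\<And>i. i < m \<Longrightarrow> left m z i = a * f i - l * (\<Sum>j<m. g j)"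
      "\<And>i. i < m \<Longrightarrow> right m z i = a * g i - l * (\<Sum>j<m. f j)"
      unfolding in_image_def by blast
    obtain x where x: "x \<in> carrier ?G" "\<And>i. i < m \<Longrightarrow> left m x i = f i" "\<And>i. i < m \<Longrightarrow> right m x i = g i"
      using ex_sides[of m f g] by blast
    have "transpose_map (sides m) M x \<in> carrier ?G"
      by (auto simp: transpose_map_def int_power_group_def)
    with z have "z = transpose_map (sides m) M x"
      by (rule sides_eqI) (simp_all add: left_M right_M fg x)
    then show "z \<in> ?I"
      using x(1) by blast
  next
    fix z assume "z \<in> ?I"
    then obtain x where x: "x \<in> carrier ?G" "z = transpose_map (sides m) M x"
      by blast
    have "z \<in> carrier ?G"
      by (auto simp: x(2) transpose_map_def int_power_group_def)
    moreover have "in_image (left m z) (right m z)"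
      unfolding in_image_def x(2) by (intro exI[of _ "left m x"] exI[of _ "right m x"]) (simp add: left_M right_M)
    ultimately show "z \<in> kernel ?G ?T h"
      unfolding kernel_def h_def in_image_iff by blast
  qed
  moreover have "h ` carrier ?G = carrier ?T"
  proof
    show "h ` carrier ?G \<subseteq> carrier ?T"
      using hom_closed by blast
    show "carrier ?T \<subseteq> h ` carrier ?G"
    proof
      fix t assume "t \<in> carrier ?T"
      then obtain t1 t2 t3 t4 where t: "t = (t1, t2, t3, t4)" "t1 \<in> carrier ?P" "t2 \<in> carrier ?Q"
        "t3 \<in> carrier ?Z3" "t4 \<in> carrier ?Z4"
        by (auto simp: DirProd_def)
      obtain z w where zw: "e_coord z w = t1 0" "e_coord w z = t1 1" "b_coord z w = t3" "f_coord z w = t4"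
        "\<And>i. i < m - 2 \<Longrightarrow> z (i + 2) - z 0 = t2 i"
        "\<And>i. i < m - 2 \<Longrightarrow> w (i + 2) - w 0 = t2 (i + (m - 2))"
        using ex_coordinates[of "t1 0" "t1 1" t3 t4 t2 "\<lambda>i. t2 (i + (m - 2))"] by blast
      obtain x where x: "x \<in> carrier ?G" "\<And>i. i < m \<Longrightarrow> left m x i = z i" "\<And>i. i < m \<Longrightarrow> right m x i = w i"
        using ex_sides[of m z w] by blast
      have D: "D (left m x) (right m x) i = t2 i" if "i < 2 * (m - 2)" for i
      proof (cases "i < m - 2")
        case True
        then show ?thesis
          using zw(5)[OF True] x(2)[of 0] x(2)[of "i + 2"] by (simp add: D_def)
      next
        case False
        then have "i - (m - 2) < m - 2"
          using that by linarith
        then show ?thesis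
          using zw(6)[of "i - (m - 2)"] x(3)[of 0] x(3)[of "i - (m - 2) + 2"] False m2
          by (simp only: D_def if_False) simp
      qed
      have F: "e_coord (left m x) (right m x) = t1 0" "e_coord (right m x) (left m x) = t1 1"
         "b_coord (left m x) (right m x) = t3" "f_coord (left m x) (right m x) = t4"
        using coord_cong[of "left m x" z "right m x" w] coord_cong(1)[of "right m x" w "left m x" z] x zw
        by simp_all
      \<comment> \<open>The entries of t1 are already reduced, and t1 is extensional, so it equals
        its own restriction.\<close>
      have "(\<lambda>i\<in>{..<2}. E (left m x) (right m x) i mod int R) = restrict t1 {..<2}"
      proof (rule restrict_ext)
        fix i :: nat assume i: "i \<in> {..<2}"
        then have "t1 i \<in> carrier (integer_mod_group R)"
          using PiE_mem[OF t(2)[unfolded carrier_product_group]] by simp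
        moreover have "i = 0 \<or> i = 1"
          using i by (simp add: less_2_cases_iff)
        ultimately show "E (left m x) (right m x) i mod int R = t1 i"
          by (auto simp: E_def F mod_carrier_id)
      qed
      also have "restrict t1 {..<2} = t1"
        using PiE_restrict[OF t(2)[unfolded carrier_product_group]] .
      finally have t1: "(\<lambda>i\<in>{..<2}. E (left m x) (right m x) i mod int R) = t1" .
      have "(\<lambda>i\<in>{..<2 * (m - 2)}. D (left m x) (right m x) i mod int N)
          = restrict t2 {..<2 * (m - 2)}"
      proof (rule restrict_ext)
        fix i assume i: "i \<in> {..<2 * (m - 2)}"
        then have "t2 i \<in> carrier (integer_mod_group N)"
          using PiE_mem[OF t(3)[unfolded carrier_product_group]] by simp
        then show "D (left m x) (right m x) i mod int N = t2 i"
          using i by (simp only: D lessThan_iff mod_carrier_id)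
      qed
      also have "restrict t2 {..<2 * (m - 2)} = t2"
        using PiE_restrict[OF t(3)[unfolded carrier_product_group]] .
      finally have t2: "(\<lambda>i\<in>{..<2 * (m - 2)}. D (left m x) (right m x) i mod int N) = t2" .
      have "h x = t"
        unfolding h_def \<phi>_def t1 t2 F t(1) using t(4,5) by (simp only: mod_carrier_id)
      then show "t \<in> h ` carrier ?G"
        using x(1) by blast
    qed
  qed
  ultimately show ?thesis
    using FactGroup_iso by metis
qed

end

section \<open>Bezout's identity and the Laplacian of the cone\<close>

lemma coprime_bezout_int:
  fixes u k :: nat
  assumes "coprime u k"
  shows "\<exists>p q. p * int u + q * int k = 1"
  using assms bezout_int[of "int u" "int k"] by (simp add: coprime_iff_gcd_eq_1)

lemma adjacency_duplication_bipartite: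
  assumes "i < p" "j < q"
  shows "adjacency (duplication l (complete_bipartite p q)) (Inl i) (Inr j) = l"
    and "adjacency (duplication l (complete_bipartite p q)) (Inr j) (Inl i) = l"
    and "adjacency (duplication l (complete_bipartite p q)) (Inl i) (Inl i') = 0"
    and "adjacency (duplication l (complete_bipartite p q)) (Inr j) (Inr j') = 0"
proof -
  let ?E = "{{Inl i, Inr j} | i j. i < p \<and> j < q} :: (nat + nat) set set"
  have "?E = (\<lambda>(i, j). {Inl i, Inr j}) ` ({..<p} \<times> {..<q})"
    by auto
  then have fin: "finite ?E"
    by simp
  have "{Inl i, Inr j} \<in> ?E" "{Inr j, Inl i} \<in> ?E" "{Inl i, Inl i'} \<notin> ?E" "{Inr j, Inr j'} \<notin> ?E"
    using assms by (auto simp: doubleton_eq_iff)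
  then show "adjacency (duplication l (complete_bipartite p q)) (Inl i) (Inr j) = l"
    "adjacency (duplication l (complete_bipartite p q)) (Inr j) (Inl i) = l"
    "adjacency (duplication l (complete_bipartite p q)) (Inl i) (Inl i') = 0"
    "adjacency (duplication l (complete_bipartite p q)) (Inr j) (Inr j') = 0"
    using fin by (auto simp: adjacency_def duplication_def complete_bipartite_def count_mset_set')
qed

lemma degree_duplication_bipartite:
  "i < p \<Longrightarrow> vertex_degree (duplication l (complete_bipartite p q)) (Inl i) = l * q"
  "j < q \<Longrightarrow> vertex_degree (duplication l (complete_bipartite p q)) (Inr j) = l * p"
proof -
  let ?E = "{{Inl i, Inr j} | i j. i < p \<and> j < q} :: (nat + nat) set set"
  have "?E = (\<lambda>(i, j). {Inl i, Inr j}) ` ({..<p} \<times> {..<q})"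
    by auto
  then have fin: "finite ?E"
    by simp
  have filt: "filter_mset P (repeat_mset l A) = repeat_mset l (filter_mset P A)"
    for P and A :: "(nat + nat) set multiset"
    by (simp add: multiset_eq_iff)
  have sz: "vertex_degree (duplication l (complete_bipartite p q)) v = l * card {e \<in> ?E. v \<in> e}" for v
    using fin
    by (simp add: vertex_degree_def duplication_def complete_bipartite_def filt filter_mset_mset_set)
  show "vertex_degree (duplication l (complete_bipartite p q)) (Inl i) = l * q" if "i < p"
  proof -
    have "{e \<in> ?E. Inl i \<in> e} = (\<lambda>j. {Inl i, Inr j}) ` {..<q}"
      using that by auto
    moreover have "inj_on (\<lambda>j. {Inl i, Inr j :: nat + nat}) {..<q}"
      by (auto simp: inj_on_def doubleton_eq_iff)
    ultimately show ?thesis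
      by (simp add: sz card_image)
  qed
  show "vertex_degree (duplication l (complete_bipartite p q)) (Inr j) = l * p" if "j < q"
  proof -
    have "{e \<in> ?E. Inr j \<in> e} = (\<lambda>i. {Inl i, Inr j}) ` {..<p}"
      using that by auto
    moreover have "inj_on (\<lambda>i. {Inl i :: nat + nat, Inr j}) {..<p}"
      by (auto simp: inj_on_def doubleton_eq_iff)
    ultimately show ?thesis
      by (simp add: sz card_image)
  qed
qed

text \<open>Each vertex has degree m l in the base and gains n edges to the sink; the only other
  nonzero entries are -l, between opposite sides.\<close>

lemma transpose_laplacian_cone_bipartite:
  fixes n l m :: nat
  defines "L \<equiv> laplacian (k_cone n (duplication l (complete_bipartite m m)))"
  assumes "i < m"
  shows "left m (transpose_map (sides m) L x) i
      = int (n + m * l) * left m x i - int l * (\<Sum>j<m. right m x j)"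
    and "right m (transpose_map (sides m) L x) i
      = int (n + m * l) * right m x i - int l * (\<Sum>j<m. left m x j)"
proof -
  let ?H = "duplication l (complete_bipartite m m)"
  have L: "L (Some u) (Some v) = laplacian ?H u v + (if u = v then int n else 0)"
    if "u \<in> Inl ` {..<m} \<union> Inr ` {..<m}" "v \<in> Inl ` {..<m} \<union> Inr ` {..<m}" for u v
    unfolding L_def
    using that by (intro laplacian_k_cone wf_duplication wf_complete_bipartite)
      (simp_all add: duplication_def complete_bipartite_def)
  have entries:
    "L (Some (Inl j)) (Some (Inl i)) = (if j = i then int (n + m * l) else 0)"
    "L (Some (Inr j)) (Some (Inr i)) = (if j = i then int (n + m * l) else 0)"
    "L (Some (Inl j)) (Some (Inr i)) = - int l"
    "L (Some (Inr j)) (Some (Inl i)) = - int l" if "j < m" for j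
    using that \<open>i < m\<close>
    by (simp_all add: L laplacian_def adjacency_duplication_bipartite degree_duplication_bipartite)
  have delta: "(\<Sum>j<m. (if j = i then c else 0) * f j) = c * f i" for c :: int and f
    using \<open>i < m\<close> by (simp add: if_distrib[of "\<lambda>t. t * _"] sum.delta' cong: if_cong)
  have in_sides: "Some (Inl i) \<in> sides m" "Some (Inr i) \<in> sides m"
    using \<open>i < m\<close> by (auto simp: sides_def)
  show "left m (transpose_map (sides m) L x) i
      = int (n + m * l) * left m x i - int l * (\<Sum>j<m. right m x j)"
    using \<open>i < m\<close> in_sides
    by (simp add: left_def right_def transpose_map_def sum_sides entries delta sum_negf sum_distrib_left
        del: of_nat_add of_nat_mult)
  show "right m (transpose_map (sides m) L x) i
      = int (n + m * l) * right m x i - int l * (\<Sum>j<m. left m x j)"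
    using \<open>i < m\<close> in_sides
    by (simp add: left_def right_def transpose_map_def sum_sides entries delta sum_negf sum_distrib_left
        del: of_nat_add of_nat_mult)
qed

theorem corollary3p11:
  fixes m l n r s :: nat
  assumes "m \<ge> 2" and "l \<ge> 1"
    and "r = gcd l n" and "s = gcd (m * l) n"
  shows "critical_group (k_cone n (duplication l (complete_bipartite m m))) None \<cong>
    product_group {..<2} (\<lambda>_::nat. integer_mod_group r) \<times>\<times>
    product_group {..<2 * (m - 2)} (\<lambda>_::nat. integer_mod_group (n + m * l)) \<times>\<times>
    integer_mod_group ((n + m * l) * s div r) \<times>\<times>
    integer_mod_group (n * (n + m * l) * (n + 2 * m * l) div (r * s))"
proof -
  define a where "a = n + m * l"
  have a0: "a > 0" and r0: "r > 0"
    using assms by (simp_all add: a_def)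
  \<comment> \<open>a and n are congruent modulo l, and also modulo m l, which serves for s
    below.\<close>
  have r: "r = gcd a l"
    using gcd_add_mult[of l m n] by (simp add: a_def assms(3) gcd.commute add.commute)
  then obtain u k where uk: "a = u * r" "l = k * r" "coprime u k"
    using gcd_coprime_exists[of a l] r0 unfolding r[symmetric] by blast
  have "s = gcd a (m * l)"
    using gcd_add_mult[of "m * l" 1 n] by (simp add: a_def assms(4) gcd.commute add.commute)
  moreover have "gcd u (m * k) * r = gcd a (m * l)"
    using gcd_mult_distrib_nat[of r u "m * k"] by (simp add: uk ac_simps)
  ultimately have s: "s = gcd u (m * k) * r"
    by simp
  have u0: "u > 0"
    using a0 uk by (cases u) auto
  define \<sigma> where \<sigma>: "\<sigma> = gcd u (m * k)"
  have \<sigma>0: "\<sigma> > 0"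
    using u0 \<sigma> by simp
  then obtain \<alpha> \<beta> where ab: "u = \<alpha> * \<sigma>" "m * k = \<beta> * \<sigma>" "coprime \<alpha> \<beta>"
    using gcd_coprime_exists[of u "m * k"] unfolding \<sigma>[symmetric] by blast
  obtain p q where pq: "p * int u + q * int k = 1"
    using coprime_bezout_int[OF uk(3)] by blast
  obtain c d where cd: "c * int \<alpha> + d * int \<beta> = 1"
    using coprime_bezout_int[OF ab(3)] by blast
  interpret bezout_data m "int a" "int l" "int r" "int \<sigma>" "int u" "int k" "int \<alpha>" "int \<beta>" p q c d
    using assms(1) uk ab pq cd
    by unfold_locales (simp_all add: mult.commute flip: of_nat_mult)
  have ml: "m * l = \<beta> * \<sigma> * r"
    using uk(2) ab(2) by simp
  have aa: "a = \<alpha> * \<sigma> * r"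
    using uk ab by simp
  have D3: "a * s div r = a * \<sigma>"
    using r0 by (simp add: s \<sigma>)
  have "int a = int \<alpha> * int \<sigma> * int r" "int (m * l) = int \<beta> * int \<sigma> * int r"
    "int n = int a - int (m * l)"
    using arg_cong[OF aa, of int] arg_cong[OF ml, of int] by (simp_all add: a_def)
  \<comment> \<open>Here n = a - m l = r \<sigma> (\<alpha> - \<beta>) and n + 2 m l = a + m l = r
    \<sigma> (\<alpha> + \<beta>), while s = r \<sigma>.\<close>
  then have "int n * (int n + 2 * int (m * l)) = int \<sigma> * ((int \<alpha>)\<^sup>2 - (int \<beta>)\<^sup>2) * (int r * (int \<sigma> * int r))"
    by Groebner_Basis.algebra
  moreover have "int (n * a * (n + 2 * m * l)) = int a * (int n * (int n + 2 * int (m * l)))"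
    by simp
  ultimately have *: "int (n * a * (n + 2 * m * l))
      = int a * int \<sigma> * ((int \<alpha>)\<^sup>2 - (int \<beta>)\<^sup>2) * int (r * s)"
    by (simp only: s \<sigma>[symmetric] of_nat_mult mult.assoc)
  have "int (n * a * (n + 2 * m * l) div (r * s)) = int (n * a * (n + 2 * m * l)) div int (r * s)"
    by (rule zdiv_int)
  also have "\<dots> = int a * int \<sigma> * ((int \<alpha>)\<^sup>2 - (int \<beta>)\<^sup>2)"
    unfolding * using r0 \<sigma>0 by (simp add: s \<sigma>[symmetric])
  finally have D4: "int (n * a * (n + 2 * m * l) div (r * s)) = int a * int \<sigma> * ((int \<alpha>)\<^sup>2 - (int \<beta>)\<^sup>2)" .
  have W: "verts (k_cone n (duplication l (complete_bipartite m m))) - {None} = sides m"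
    by (auto simp: k_cone_def duplication_def complete_bipartite_def sides_def)
  show ?thesis
    unfolding critical_group_def W Let_def a_def[symmetric]
    by (rule cokernel_iso[OF refl refl _ D4])
      (simp_all add: D3 transpose_laplacian_cone_bipartite flip: a_def)
qed

end
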